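(* Let $k$ be an algebraically closed field of characteristic zero and let $L$ be a solvable Lie algebra over $k$ of dimension $n$. (1) If $n\le 6$, then $L$ has Rentschler's property. (2) Let $n=7$. Then $L$ has Rentschler's property if one of the following conditions is satisfied: (i) $i(L)\ne 3$; (ii) $i(L)=3$ and $L$ is not quasi quadratic.
   Context: All Lie algebras are finite dimensional over $k$. For $\xi\in L^*$ put $L(\xi)=\{x\in L : \xi([x,y])=0 \text{ for all } y\in L\}$; the index is $i(L)=\min_{\xi\in L^*}\dim L(\xi)$; $\xi$ is regular if $\dim L(\xi)=i(L)$, and $L^*_{\mathrm{reg}}$ is the set of regular elements. The magic number is $c(L)=(\dim L+i(L))/2$ (an integer). The Frobenius semiradical is $F(L)=\sum_{\xi\in L^*_{\mathrm{reg}}}L(\xi)$, and $L$ is quasi quadratic if $F(L)=L$. $\alpha(L)$ denotes the maximum dimension of an abelian subalgebra of $L$. $L$ has Rentschler's property if $\alpha(L)\ge c(L)-1$. *)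

theory Defs
  imports "HOL-Computational_Algebra.Polynomial"
begin

locale lie_algebra = vector_space scale
  for scale :: "'k::field \<Rightarrow> 'v::ab_group_add \<Rightarrow> 'v" (infixr "*s" 75) +
  fixes bracket :: "'v \<Rightarrow> 'v \<Rightarrow> 'v"
  assumes linear_bracket_left: "Vector_Spaces.linear scale scale (\<lambda>x. bracket x y)"
    and linear_bracket_right: "Vector_Spaces.linear scale scale (\<lambda>y. bracket x y)"
    and bracket_self: "bracket x x = 0"
    and jacobi:
      "bracket x (bracket y z) + bracket y (bracket z x) + bracket z (bracket x y) = 0"
begin

definition subalgebra :: "'v set \<Rightarrow> bool" where
  "subalgebra A \<longleftrightarrow> subspace A \<and> (\<forall>x\<in>A. \<forall>y\<in>A. bracket x y \<in> A)"

definition abelian :: "'v set \<Rightarrow> bool" where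
  "abelian A \<longleftrightarrow> (\<forall>x\<in>A. \<forall>y\<in>A. bracket x y = 0)"

primrec derived_series :: "nat \<Rightarrow> 'v set" where
  "derived_series 0 = UNIV"
| "derived_series (Suc n) =
     span {bracket x y |x y. x \<in> derived_series n \<and> y \<in> derived_series n}"

definition solvable :: bool where
  "solvable \<longleftrightarrow> (\<exists>n. derived_series n = {0})"

definition dual :: "('v \<Rightarrow> 'k) set" where
  "dual = {\<xi>. Vector_Spaces.linear scale (*) \<xi>}"

definition stabilizer :: "('v \<Rightarrow> 'k) \<Rightarrow> 'v set" where
  "stabilizer \<xi> = {x. \<forall>y. \<xi> (bracket x y) = 0}"

definition index :: nat where
  "index = Min ((\<lambda>\<xi>. dim (stabilizer \<xi>)) ` dual)"

definition regular :: "('v \<Rightarrow> 'k) set" where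
  "regular = {\<xi> \<in> dual. dim (stabilizer \<xi>) = index}"

text \<open>The magic number, taken in \<open>real\<close> to avoid truncating division and subtraction.\<close>

definition magic_number :: real where
  "magic_number = (real (dim UNIV) + real index) / 2"

text \<open>The sum of a family of subspaces is the span of its union.\<close>

definition frobenius_semiradical :: "'v set" where
  "frobenius_semiradical = span (\<Union>\<xi>\<in>regular. stabilizer \<xi>)"

definition quasi_quadratic :: bool where
  "quasi_quadratic \<longleftrightarrow> frobenius_semiradical = UNIV"

definition max_abelian_dim :: nat where
  "max_abelian_dim = Max {dim A |A. subalgebra A \<and> abelian A}"

definition rentschler_property :: bool where
  "rentschler_property \<longleftrightarrow> real max_abelian_dim \<ge> magic_number - 1"

end

locale finite_dimensional_lie_algebra = lie_algebra +
  assumes finite_dimensional: "\<exists>B. finite B \<and> span B = UNIV"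
begin

lemma dim_le_dim_UNIV: "dim A \<le> dim UNIV"
proof -
  obtain C where C: "finite C" "span C = UNIV"
    using finite_dimensional by blast
  obtain B where B: "B \<subseteq> C" "independent B" "C \<subseteq> span B"
    using maximal_independent_subset[of C] by blast
  have "UNIV \<subseteq> span B"
    using C(2) B(3) span_minimal subspace_span by blast
  then interpret finite_dimensional_vector_space scale B
    using finite_subset[OF B(1) C(1)] B(2) by unfold_locales auto
  show ?thesis
    by (rule dim_subset) simp
qed

text \<open>The minimum and the maximum in \<open>index\<close> and \<open>max_abelian_dim\<close> range over
  finite nonempty sets.\<close>

lemma finite_stabilizer_dims: "finite ((\<lambda>\<xi>. dim (stabilizer \<xi>)) ` dual)"
  by (rule finite_subset[of _ "{..dim UNIV}"]) (auto simp: dim_le_dim_UNIV)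

lemma dual_nonempty: "dual \<noteq> {}"
proof -
  have "(\<lambda>_. 0) \<in> dual"
    unfolding dual_def mem_Collect_eq by unfold_locales (auto simp: algebra_simps)
  then show ?thesis by blast
qed

lemma finite_abelian_dims: "finite {dim A |A. subalgebra A \<and> abelian A}"
  by (rule finite_subset[of _ "{..dim UNIV}"]) (auto simp: dim_le_dim_UNIV)

lemma abelian_dims_nonempty: "{dim A |A. subalgebra A \<and> abelian A} \<noteq> {}"
proof -
  have "subalgebra {0} \<and> abelian {0}"
    by (auto simp: subalgebra_def abelian_def bracket_self subspace_def)
  then show ?thesis by blast
qed

end

end

theory Submission
  imports Defs
begin

text \<open>
  Every functional \<open>\<xi>\<close> makes \<open>L\<close>, and each of its subspaces \<open>H\<close>, carry the alternating form
  \<open>\<xi> [x, y]\<close>. Its rank is even, so \<open>i(L) = n - 2m\<close> with \<open>2m\<close> the largest rank that occurs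
  (\<open>even_dim_minus_index\<close>), and Rentschler's property asks for an abelian subalgebra of
  codimension at most \<open>m + 1\<close>. An abelian subspace is automatically a subalgebra, which leaves
  two sources of abelian subspaces.

  The first is linear algebra and serves \<open>m = 1\<close> (for \<open>m = 0\<close> all of \<open>L\<close> is abelian). If on a subspace \<open>H\<close> all the forms have rank at
  most 2, then the radical on \<open>H\<close> of any nonzero one among them is abelian: a rank bounded by 2
  means that all \<open>4 \<times> 4\<close> Pfaffians vanish, and perturbing \<open>\<xi>\<close> to \<open>\<xi> \<plusminus> \<eta>\<close> in this quadratic equation
  kills \<open>\<eta> [r, s]\<close> for \<open>r, s\<close> in the radical (\<open>abelian_perp_if_pfaffians_vanish\<close>). So \<open>H\<close> contains
  an abelian subspace of codimension at most 2.

  The second is Lie's theorem and serves \<open>m \<ge> 2\<close>. A flag of ideals \<open>\<langle>x\<rangle> \<subset> \<langle>x, y\<rangle>\<close> with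
  \<open>[x, y] = 0\<close> gives a commuting pair when \<open>n \<ge> 3\<close>, and since the joint centralizer of \<open>x, y\<close> has
  codimension at most 3, a commuting triple when \<open>n \<ge> 6\<close>. Now \<open>m \<ge> 2\<close> means \<open>i(L) \<le> n - 4\<close>, and
  codimension 3 is enough. For \<open>n \<le> 6\<close> the triple, the pair or a smaller space has it; for
  \<open>n = 7\<close> and \<open>i(L) = 1\<close> the triple has the required dimension 3.

  What remains is \<open>n = 7\<close>, \<open>i(L) = 3\<close>, where dimension 4 is required. If \<open>F(L) \<noteq> L\<close>, choose a
  hyperplane \<open>H\<close> containing \<open>F(L)\<close>. A form of rank 4 on \<open>H\<close> would belong to a regular \<open>\<xi>\<close>, whose
  stabilizer has dimension 3 and lies in \<open>H\<close>; it would then lie in the radical on \<open>H\<close>, which has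
  dimension \<open>6 - 4 = 2\<close>. So all forms have rank at most 2 on \<open>H\<close>, and the first source gives an
  abelian subspace of dimension 4 (\<open>max_abelian_dim_if_not_quasi_quadratic\<close>).
\<close>

section \<open>Codimension and iterates of a linear map\<close>

context finite_dimensional_vector_space
begin

lemma dim_insert_subspace:
  assumes "subspace S" "a \<notin> S"
  shows "dim (insert a S) = dim S + 1"
  using assms by (simp add: dim_insert span_eq_iff[THEN iffD2])

lemma dim_le_Suc_if_modulo_line:
  assumes "\<And>z. z \<in> H \<Longrightarrow> \<exists>c. z - c *s a \<in> S"
  shows "dim H \<le> dim S + 1"
proof -
  have "H \<subseteq> span (insert a S)"
    using assms by (auto simp: span_insert intro: span_base)
  then have "dim H \<le> dim (insert a S)"
    by (metis dim_span dim_subset)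
  then show ?thesis
    by (simp add: dim_insert split: if_splits)
qed

text \<open>This is rank-nullity for the map that \<open>f\<close> induces from \<open>H\<close> to the quotient by \<open>K\<close>, whose image
  lies on the line of \<open>w\<close>. It bounds the codimension of a centralizer of a common eigenvector.\<close>

lemma dim_le_Suc_if_image_modulo_line:
  assumes f: "Vector_Spaces.linear scale scale f"
    and K: "subspace K" and H: "subspace H"
    and line: "\<And>z. z \<in> H \<Longrightarrow> \<exists>c. f z - c *s w \<in> K"
  shows "dim H \<le> dim {z \<in> H. f z \<in> K} + 1"
proof (cases "H \<subseteq> {z. f z \<in> K}")
  case True
  then have "{z \<in> H. f z \<in> K} = H" by blast
  then show ?thesis by simp
next
  case False
  interpret f: Vector_Spaces.linear scale scale f by fact
  obtain a where a: "a \<in> H" "f a \<notin> K" using False by blast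
  obtain c where c: "f a - c *s w \<in> K" using line a by blast
  have "c \<noteq> 0" using c a by auto
  show ?thesis
  proof (rule dim_le_Suc_if_modulo_line)
    fix z assume z: "z \<in> H"
    then obtain d where d: "f z - d *s w \<in> K" using line by blast
    have "f (z - (d / c) *s a) = (f z - d *s w) - (d / c) *s (f a - c *s w)"
      using \<open>c \<noteq> 0\<close> by (simp add: f.diff f.scale scale_right_diff_distrib)
    also have "\<dots> \<in> K" using K c d by (simp add: subspace_diff subspace_scale)
    finally show "\<exists>c. z - c *s a \<in> {z \<in> H. f z \<in> K}"
      using z a H by (blast intro: subspace_diff subspace_scale)
  qed
qed

lemma proper_subspace_in_hyperplane:
  assumes "subspace S" "S \<noteq> UNIV"
  obtains H where "subspace H" "S \<subseteq> H" "dim H + 1 = dim UNIV"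
proof -
  obtain C where C: "C \<subseteq> S" "independent C" "S \<subseteq> span C"
    using basis_exists[of S] by metis
  obtain B where B: "C \<subseteq> B" "independent B" "UNIV \<subseteq> span B"
    using maximal_independent_subset_extend[of C UNIV] C(2) by auto
  have "span C \<subseteq> S" using C(1) assms(1) by (rule span_minimal)
  then have "B \<noteq> C" using B(3) assms(2) by auto
  then obtain b where b: "b \<in> B" "b \<notin> C" using B(1) by blast
  have fin: "finite B" using B(2) by (rule finiteI_independent)
  have "independent (B - {b})" using B(2) by (rule independent_mono) blast
  then have "dim (span (B - {b})) = card (B - {b})"
    by (rule dim_span_eq_card_independent)
  moreover have "dim UNIV = card B"
    using B by (intro dim_eq_card) auto
  ultimately have "dim (span (B - {b})) + 1 = dim UNIV"
    using card.remove[OF fin b(1)] by linarith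
  moreover have "S \<subseteq> span (B - {b})"
    using C(3) span_mono[of C "B - {b}"] B(1) b by blast
  ultimately show thesis using that subspace_span by blast
qed

text \<open>Quotients by \<open>K\<close> are expressed throughout by subspaces containing \<open>K\<close>; this is the preimage of
  the Krylov subspace generated by the class of \<open>y\<close>.\<close>

definition krylov :: "('b \<Rightarrow> 'b) \<Rightarrow> 'b set \<Rightarrow> 'b \<Rightarrow> nat \<Rightarrow> 'b set" where
  "krylov T K y n = span (K \<union> (\<lambda>i. (T ^^ i) y) ` {..<n})"

lemma subspace_krylov: "subspace (krylov T K y n)"
  by (simp add: krylov_def)

lemma krylov_0: "subspace K \<Longrightarrow> krylov T K y 0 = K"
  by (simp add: krylov_def span_eq_iff[THEN iffD2])

lemma krylov_mono: "m \<le> n \<Longrightarrow> krylov T K y m \<subseteq> krylov T K y n"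
  unfolding krylov_def by (intro span_mono) auto

lemma krylov_base: "K \<subseteq> krylov T K y n"
  unfolding krylov_def by (auto intro: span_base)

lemma iterate_in_krylov: "i < n \<Longrightarrow> (T ^^ i) y \<in> krylov T K y n"
  unfolding krylov_def by (auto intro: span_base)

lemma krylov_shift:
  assumes T: "Vector_Spaces.linear scale scale T" and K: "\<And>k. k \<in> K \<Longrightarrow> T k \<in> K"
    and v: "v \<in> krylov T K y n"
  shows "T v \<in> krylov T K y (Suc n)"
proof -
  interpret T: Vector_Spaces.linear scale scale T by fact
  have "T v \<in> span (T ` (K \<union> (\<lambda>i. (T ^^ i) y) ` {..<n}))"
    using v unfolding krylov_def T.span_image by blast
  also have "\<dots> \<subseteq> krylov T K y (Suc n)"
  proof (rule span_minimal)
    show "T ` (K \<union> (\<lambda>i. (T ^^ i) y) ` {..<n}) \<subseteq> krylov T K y (Suc n)"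
    proof -
      have "T ((T ^^ i) y) \<in> krylov T K y (Suc n)" if "i < n" for i
        using iterate_in_krylov[of "Suc i" "Suc n"] that by simp
      then show ?thesis using K krylov_base by fastforce
    qed
  qed (rule subspace_krylov)
  finally show ?thesis .
qed

text \<open>A strictly increasing chain of subspaces would exceed the dimension of the space.\<close>

lemma krylov_stops: "\<exists>n. (T ^^ n) y \<in> krylov T K y n"
proof (rule ccontr)
  assume "\<not> ?thesis"
  then have new: "(T ^^ n) y \<notin> krylov T K y n" for n by blast
  have "n \<le> dim (krylov T K y n)" for n
  proof (induction n)
    case (Suc n)
    have "insert ((T ^^ n) y) (krylov T K y n) \<subseteq> krylov T K y (Suc n)"
      using krylov_mono[of n "Suc n"] iterate_in_krylov[of n "Suc n"] by auto
    then have "dim (krylov T K y n) + 1 \<le> dim (krylov T K y (Suc n))"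
      using dim_subset dim_insert_subspace[OF subspace_krylov new] by metis
    then show ?case using Suc by linarith
  qed simp
  then show False
    using dim_subset_UNIV[of "krylov T K y (Suc dimension)"] by (metis not_less_eq_eq order_trans)
qed

definition apply_poly :: "('b \<Rightarrow> 'b) \<Rightarrow> 'a poly \<Rightarrow> 'b \<Rightarrow> 'b" where
  "apply_poly T p y = (\<Sum>i\<le>degree p. coeff p i *s (T ^^ i) y)"

lemma apply_poly_eq_sum:
  assumes "\<And>i. i \<ge> N \<Longrightarrow> coeff p i = 0"
  shows "apply_poly T p y = (\<Sum>i<N. coeff p i *s (T ^^ i) y)"
proof -
  have "apply_poly T p y = (\<Sum>i\<in>{..degree p} \<union> {..<N}. coeff p i *s (T ^^ i) y)"
    unfolding apply_poly_def
    by (rule sum.mono_neutral_left) (auto simp: coeff_eq_0)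
  also have "\<dots> = (\<Sum>i<N. coeff p i *s (T ^^ i) y)"
    by (rule sum.mono_neutral_right) (auto simp: assms)
  finally show ?thesis .
qed

lemma apply_poly_0 [simp]: "apply_poly T 0 y = 0"
  by (simp add: apply_poly_def)

lemma apply_poly_monom [simp]: "apply_poly T (monom c n) y = c *s (T ^^ n) y"
proof -
  let ?t = "\<lambda>i. coeff (monom c n) i *s (T ^^ i) y"
  have "apply_poly T (monom c n) y = sum ?t {..<Suc n}"
    by (rule apply_poly_eq_sum) simp
  also have "\<dots> = sum ?t {..<n} + ?t n" by (rule sum.lessThan_Suc)
  also have "sum ?t {..<n} = 0" by (rule sum.neutral) simp
  finally show ?thesis by simp
qed

lemma apply_poly_add: "apply_poly T (p + q) y = apply_poly T p y + apply_poly T q y"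
proof -
  let ?N = "Suc (max (degree p) (degree q))"
  have "coeff p i = 0" "coeff q i = 0" if "i \<ge> ?N" for i
    using that by (auto intro: coeff_eq_0)
  then show ?thesis
    by (simp add: apply_poly_eq_sum[of ?N] scale_left_distrib sum.distrib)
qed

lemma apply_poly_smult: "apply_poly T (smult c p) y = c *s apply_poly T p y"
proof -
  have "coeff p i = 0" if "i \<ge> Suc (degree p)" for i
    using that by (auto intro: coeff_eq_0)
  then show ?thesis
    by (simp add: apply_poly_eq_sum[of "Suc (degree p)"] scale_sum_right del: sum.lessThan_Suc)
qed

lemma apply_poly_pCons:
  assumes "Vector_Spaces.linear scale scale T"
  shows "apply_poly T (pCons c p) y = c *s y + T (apply_poly T p y)"
proof -
  interpret T: Vector_Spaces.linear scale scale T by fact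
  let ?N = "Suc (degree p)"
  have 0: "coeff p i = 0" if "i \<ge> ?N" for i
    using that by (auto intro: coeff_eq_0)
  have "coeff (pCons c p) i = 0" if "i \<ge> Suc ?N" for i
    using that 0 by (cases i) auto
  then have "apply_poly T (pCons c p) y
      = (\<Sum>i<Suc ?N. coeff (pCons c p) i *s (T ^^ i) y)"
    by (rule apply_poly_eq_sum)
  also have "\<dots> = c *s y + (\<Sum>i<?N. coeff p i *s T ((T ^^ i) y))"
    by (subst sum.lessThan_Suc_shift) simp
  also have "\<dots> = c *s y + T (apply_poly T p y)"
    using 0 by (subst apply_poly_eq_sum[of ?N]) (auto simp: T.sum T.scale simp del: sum.lessThan_Suc)
  finally show ?thesis .
qed

lemma in_krylov_imp_apply_poly:
  assumes K: "subspace K" and v: "v \<in> krylov T K y n"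
  shows "\<exists>p. (\<forall>i\<ge>n. coeff p i = 0) \<and> v - apply_poly T p y \<in> K"
proof -
  let ?S = "{v. \<exists>p. (\<forall>i\<ge>n. coeff p i = 0) \<and> v - apply_poly T p y \<in> K}"
  have "krylov T K y n \<subseteq> ?S"
    unfolding krylov_def
  proof (rule span_minimal)
    show "K \<union> (\<lambda>i. (T ^^ i) y) ` {..<n} \<subseteq> ?S"
    proof -
      have "v \<in> ?S" if "v \<in> K" for v
        using that by (intro CollectI exI[of _ 0]) simp
      moreover have "(T ^^ i) y \<in> ?S" if "i < n" for i
        using that K by (intro CollectI exI[of _ "monom 1 i"]) (auto simp: subspace_0)
      ultimately show ?thesis by blast
    qed
    show "subspace ?S"
    proof (rule subspaceI)
      show "0 \<in> ?S" using K by (intro CollectI exI[of _ 0]) (simp add: subspace_0)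
    next
      fix v w assume "v \<in> ?S" "w \<in> ?S"
      then obtain p q where pq: "\<forall>i\<ge>n. coeff p i = 0" "v - apply_poly T p y \<in> K"
        "\<forall>i\<ge>n. coeff q i = 0" "w - apply_poly T q y \<in> K" by blast
      have "(v + w) - apply_poly T (p + q) y \<in> K"
        using subspace_add[OF K pq(2,4)] by (simp add: apply_poly_add algebra_simps)
      then show "v + w \<in> ?S" using pq by (intro CollectI exI[of _ "p + q"]) simp
    next
      fix c v assume "v \<in> ?S"
      then obtain p where p: "\<forall>i\<ge>n. coeff p i = 0" "v - apply_poly T p y \<in> K" by blast
      have "c *s v - apply_poly T (smult c p) y \<in> K"
        using subspace_scale[OF K p(2)] by (simp add: apply_poly_smult scale_right_diff_distrib)
      then show "c *s v \<in> ?S" using p by (intro CollectI exI[of _ "smult c p"]) simp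
    qed
  qed
  then show ?thesis using v by blast
qed

end

locale alg_closed_finite_dimensional_space =
  finite_dimensional_vector_space scale Basis
  for scale :: "'k::alg_closed_field \<Rightarrow> 'v::ab_group_add \<Rightarrow> 'v" (infixr "*s" 75)
    and Basis :: "'v set"
begin

text \<open>Among the nonzero polynomials \<open>p\<close> with \<open>p(T) y \<in> K\<close> take one of least degree. It has a root
  \<open>\<mu>\<close>, and its cofactor \<open>q\<close> satisfies \<open>(T - \<mu>) q(T) y \<in> K\<close>, while \<open>q(T) y \<notin> K\<close> by minimality.\<close>

lemma eigenvector_modulo_subspace:
  assumes T: "Vector_Spaces.linear scale scale T"
    and K: "subspace K" and N: "subspace N" and TN: "\<And>v. v \<in> N \<Longrightarrow> T v \<in> N"
    and y: "y \<in> N" "y \<notin> K"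
  shows "\<exists>w \<in> N - K. \<exists>\<mu>. T w - \<mu> *s w \<in> K"
proof -
  interpret T: Vector_Spaces.linear scale scale T by fact
  let ?P = "\<lambda>p. p \<noteq> 0 \<and> apply_poly T p y \<in> K"
  obtain n where "(T ^^ n) y \<in> krylov T K y n" using krylov_stops by blast
  then obtain r where r: "\<forall>i\<ge>n. coeff r i = 0" "(T ^^ n) y - apply_poly T r y \<in> K"
    using in_krylov_imp_apply_poly[OF K] by blast
  have "coeff (monom 1 n + smult (- 1) r) n \<noteq> 0" using r(1) by simp
  then have "monom 1 n + smult (- 1) r \<noteq> 0" by (metis coeff_0)
  then have "?P (monom 1 n + smult (- 1) r)"
    using r(2) by (simp add: apply_poly_add apply_poly_smult del: smult_minus_left)
  then obtain p where p: "?P p" "\<And>q. ?P q \<Longrightarrow> degree p \<le> degree q"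
    using ex_has_least_nat[of ?P _ degree] by blast
  have "degree p \<noteq> 0"
  proof
    assume "degree p = 0"
    then obtain c where c: "p = [:c:]" by (rule degree_eq_zeroE)
    then have "c \<noteq> 0" "c *s y \<in> K" using p(1) by (auto simp: apply_poly_def)
    then have "(1 / c) *s (c *s y) \<in> K" using K subspace_scale by blast
    then show False using \<open>c \<noteq> 0\<close> y by simp
  qed
  then obtain \<mu> where "poly p \<mu> = 0" using alg_closed_imp_poly_has_root[of p] by auto
  then obtain q where q: "p = [:- \<mu>, 1:] * q" by (metis poly_eq_0_iff_dvd dvdE)
  have q0: "q \<noteq> 0" using p(1) q by auto
  have "degree p = degree q + 1" unfolding q using q0 by (subst degree_mult_eq) auto
  then have qK: "apply_poly T q y \<notin> K" using p(2)[of q] q0 by auto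
  have "apply_poly T p y = T (apply_poly T q y) - \<mu> *s apply_poly T q y"
    by (simp add: q apply_poly_add apply_poly_smult apply_poly_pCons[OF T]
        del: smult_minus_left)
  then have "T (apply_poly T q y) - \<mu> *s apply_poly T q y \<in> K" using p(1) by simp
  moreover have "(T ^^ i) y \<in> N" for i by (induction i) (auto simp: y TN)
  then have "apply_poly T q y \<in> N"
    unfolding apply_poly_def by (intro subspace_sum subspace_scale N)
  ultimately show ?thesis using qK by blast
qed

end

section \<open>Alternating forms given by functionals\<close>

context lie_algebra
begin

lemma bracket_left_simps:
  "bracket (x + x') y = bracket x y + bracket x' y"
  "bracket (x - x') y = bracket x y - bracket x' y"
  "bracket (c *s x) y = c *s bracket x y"
  "bracket 0 y = 0"
proof -
  interpret l: Vector_Spaces.linear scale scale "\<lambda>x. bracket x y" by (rule linear_bracket_left)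
  show "bracket (x + x') y = bracket x y + bracket x' y"
    "bracket (x - x') y = bracket x y - bracket x' y"
    "bracket (c *s x) y = c *s bracket x y" "bracket 0 y = 0"
    by (rule l.add l.diff l.scale l.zero)+
qed

lemma bracket_right_simps:
  "bracket x (y + y') = bracket x y + bracket x y'"
  "bracket x (y - y') = bracket x y - bracket x y'"
  "bracket x (c *s y) = c *s bracket x y"
  "bracket x 0 = 0"
proof -
  interpret r: Vector_Spaces.linear scale scale "bracket x" by (rule linear_bracket_right)
  show "bracket x (y + y') = bracket x y + bracket x y'"
    "bracket x (y - y') = bracket x y - bracket x y'"
    "bracket x (c *s y) = c *s bracket x y" "bracket x 0 = 0"
    by (rule r.add r.diff r.scale r.zero)+
qed

lemmas bracket_simps = bracket_left_simps bracket_right_simps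

lemma bracket_antisym: "bracket x y = - bracket y x"
proof -
  have "bracket (x + y) (x + y) = 0" by (rule bracket_self)
  then have "bracket x y + bracket y x = 0"
    by (subst (asm) bracket_left_simps(1)) (simp add: bracket_right_simps bracket_self add.commute)
  then show ?thesis by (rule eq_neg_iff_add_eq_0[THEN iffD2])
qed

lemma bracket_leibniz: "bracket a (bracket z v) = bracket (bracket a z) v + bracket z (bracket a v)"
proof -
  have "bracket a (bracket z v) + bracket z (bracket v a) + bracket v (bracket a z) = 0"
    by (rule jacobi)
  moreover have "bracket z (bracket v a) = - bracket z (bracket a v)"
    using bracket_antisym[of v a] bracket_right_simps(2)[of z 0 "bracket a v"]
    by (simp add: bracket_simps)
  ultimately show ?thesis
    using bracket_antisym[of v "bracket a z"] by (simp add: algebra_simps eq_neg_iff_add_eq_0)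
qed

lemma dual_simps:
  assumes "\<xi> \<in> dual"
  shows "\<xi> (x + y) = \<xi> x + \<xi> y" "\<xi> (x - y) = \<xi> x - \<xi> y" "\<xi> (c *s x) = c * \<xi> x"
    "\<xi> 0 = 0" "\<xi> (- x) = - \<xi> x"
proof -
  interpret \<xi>: Vector_Spaces.linear scale "(*)" \<xi> using assms by (simp add: dual_def)
  show "\<xi> (x + y) = \<xi> x + \<xi> y" "\<xi> (x - y) = \<xi> x - \<xi> y" "\<xi> (c *s x) = c * \<xi> x"
    "\<xi> 0 = 0" "\<xi> (- x) = - \<xi> x"
    by (rule \<xi>.add \<xi>.diff \<xi>.scale \<xi>.zero \<xi>.neg)+
qed

lemma vector_space_mult: "vector_space ((*) :: 'k \<Rightarrow> 'k \<Rightarrow> 'k)"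
  by unfold_locales (auto simp: algebra_simps)

lemma dualI:
  assumes "\<And>x y. \<xi> (x + y) = \<xi> x + \<xi> y" "\<And>c x. \<xi> (c *s x) = c * \<xi> x"
  shows "\<xi> \<in> dual"
proof -
  show ?thesis unfolding dual_def using assms vector_space_mult vector_space_axioms by (simp add: Vector_Spaces.linear_iff)
qed

text \<open>A vector is zero once all functionals vanish on it; this is how equations between the forms
  \<open>\<xi> [x, y]\<close> are turned into equations between brackets.\<close>

lemma dual_separates:
  assumes "v \<noteq> 0"
  obtains \<xi> where "\<xi> \<in> dual" "\<xi> v \<noteq> 0"
proof -
  interpret pair: vector_space_pair scale "(*) :: 'k \<Rightarrow> 'k \<Rightarrow> 'k"
    using vector_space_mult vector_space_axioms by (simp add: vector_space_pair_def)
  have ind: "independent {v}" using assms by simp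
  let ?\<xi> = "pair.construct {v} (\<lambda>_. 1)"
  have "?\<xi> \<in> dual" unfolding dual_def using pair.linear_construct[OF ind] by simp
  moreover have "?\<xi> v \<noteq> 0" using pair.construct_basis[OF ind, of v] by simp
  ultimately show thesis by (rule that)
qed

lemma dual_bracket_antisym: "\<xi> \<in> dual \<Longrightarrow> \<xi> (bracket x y) = - \<xi> (bracket y x)"
  by (subst bracket_antisym) (rule dual_simps(5))

definition radical :: "('v \<Rightarrow> 'k) \<Rightarrow> 'v set \<Rightarrow> 'v set" where
  "radical \<xi> H = {x \<in> H. \<forall>y \<in> H. \<xi> (bracket x y) = 0}"

definition perp :: "('v \<Rightarrow> 'k) \<Rightarrow> 'v set \<Rightarrow> 'v \<Rightarrow> 'v \<Rightarrow> 'v set" where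
  "perp \<xi> H a b = {x \<in> H. \<xi> (bracket a x) = 0 \<and> \<xi> (bracket b x) = 0}"

text \<open>The Pfaffian of the Gram matrix of \<open>a, b, c, d\<close> under the form \<open>\<xi> [x, y]\<close>. It is nonzero for some
  vectors of \<open>H\<close> exactly when the form has rank at least 4 on \<open>H\<close>.\<close>

definition pfaffian :: "('v \<Rightarrow> 'k) \<Rightarrow> 'v \<Rightarrow> 'v \<Rightarrow> 'v \<Rightarrow> 'v \<Rightarrow> 'k" where
  "pfaffian \<xi> a b c d = \<xi> (bracket a b) * \<xi> (bracket c d)
     - \<xi> (bracket a c) * \<xi> (bracket b d) + \<xi> (bracket a d) * \<xi> (bracket b c)"

lemma stabilizer_eq_radical: "stabilizer \<xi> = radical \<xi> UNIV"
  by (simp add: stabilizer_def radical_def)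

lemma stabilizer_subset_radical: "stabilizer \<xi> \<subseteq> H \<Longrightarrow> stabilizer \<xi> \<subseteq> radical \<xi> H"
  by (auto simp: stabilizer_def radical_def)

lemma subspace_perp:
  assumes \<xi>: "\<xi> \<in> dual" and H: "subspace H"
  shows "subspace (perp \<xi> H a b)"
  using H by (auto simp: perp_def subspace_def bracket_simps dual_simps[OF \<xi>])

text \<open>A hyperbolic plane splits off from an alternating form: \<open>a\<close> and \<open>b\<close> span a complement of their
  orthogonal space.\<close>

lemma perp_complement:
  assumes \<xi>: "\<xi> \<in> dual" and H: "subspace H" and ab: "a \<in> H" "b \<in> H" "\<xi> (bracket a b) \<noteq> 0"
    and z: "z \<in> H"
  shows "\<exists>c d. z - c *s a - d *s b \<in> perp \<xi> H a b"
proof (intro exI)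
  let ?e = "\<xi> (bracket a b)"
  let ?c = "- (\<xi> (bracket b z) / ?e)" and ?d = "\<xi> (bracket a z) / ?e"
  have "\<xi> (bracket b a) = - ?e" by (rule dual_bracket_antisym[OF \<xi>])
  then show "z - ?c *s a - ?d *s b \<in> perp \<xi> H a b"
    using assms by (auto simp: perp_def bracket_simps bracket_self dual_simps[OF \<xi>]
        simp del: scale_minus_left intro!: subspace_diff subspace_scale)
qed

lemma radical_perp:
  assumes \<xi>: "\<xi> \<in> dual" and H: "subspace H" and ab: "a \<in> H" "b \<in> H" "\<xi> (bracket a b) \<noteq> 0"
  shows "radical \<xi> (perp \<xi> H a b) = radical \<xi> H"
proof
  show "radical \<xi> H \<subseteq> radical \<xi> (perp \<xi> H a b)"
  proof
    fix x assume x: "x \<in> radical \<xi> H"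
    then show "x \<in> radical \<xi> (perp \<xi> H a b)"
      using ab dual_bracket_antisym[OF \<xi>, of a x] dual_bracket_antisym[OF \<xi>, of b x]
      by (auto simp: radical_def perp_def)
  qed
  show "radical \<xi> (perp \<xi> H a b) \<subseteq> radical \<xi> H"
  proof
    fix x assume x: "x \<in> radical \<xi> (perp \<xi> H a b)"
    have xa: "x \<in> H" "\<xi> (bracket x a) = 0" "\<xi> (bracket x b) = 0"
      using x dual_bracket_antisym[OF \<xi>, of x a] dual_bracket_antisym[OF \<xi>, of x b]
      by (auto simp: radical_def perp_def)
    have "\<xi> (bracket x z) = 0" if "z \<in> H" for z
    proof -
      obtain c d where "z - c *s a - d *s b \<in> perp \<xi> H a b"
        using perp_complement[OF \<xi> H ab \<open>z \<in> H\<close>] by blast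
      then have "\<xi> (bracket x (z - c *s a - d *s b)) = 0" using x by (auto simp: radical_def)
      then show ?thesis using xa \<xi> by (simp add: bracket_simps dual_simps[OF \<xi>])
    qed
    then show "x \<in> radical \<xi> H" using xa by (auto simp: radical_def)
  qed
qed

text \<open>For \<open>r, s\<close> orthogonal to \<open>a, b\<close> under \<open>\<xi>\<close>, the Pfaffian of \<open>\<xi> + t \<eta>\<close> on \<open>a, b, r, s\<close> is
  \<open>t \<xi>[a, b] \<eta>[r, s]\<close> plus a term of order \<open>t\<^sup>2\<close>, once \<open>\<xi>[r, s] = 0\<close> is known. Comparing \<open>t = 1\<close>
  with \<open>t = -1\<close> isolates the linear term, so \<open>\<eta>[r, s] = 0\<close> for every \<open>\<eta>\<close>.\<close>

lemma abelian_perp_if_pfaffians_vanish: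
  assumes char: "(2 :: 'k) \<noteq> 0"
    and \<xi>: "\<xi> \<in> dual" and H: "subspace H" and ab: "a \<in> H" "b \<in> H" "\<xi> (bracket a b) \<noteq> 0"
    and pf: "\<And>\<xi> a b c d. \<xi> \<in> dual \<Longrightarrow> {a, b, c, d} \<subseteq> H \<Longrightarrow> pfaffian \<xi> a b c d = 0"
  shows "abelian (perp \<xi> H a b)"
  unfolding abelian_def
proof (intro ballI)
  fix r s assume rs: "r \<in> perp \<xi> H a b" "s \<in> perp \<xi> H a b"
  then have rs_H: "{a, b, r, s} \<subseteq> H" using ab by (auto simp: perp_def)
  show "bracket r s = 0"
  proof (rule ccontr)
    assume "bracket r s \<noteq> 0"
    then obtain \<eta> where \<eta>: "\<eta> \<in> dual" "\<eta> (bracket r s) \<noteq> 0" by (rule dual_separates)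
    have "pfaffian \<xi> a b r s = 0" using pf \<xi> rs_H by blast
    then have rs0: "\<xi> (bracket r s) = 0" using rs ab by (auto simp: pfaffian_def perp_def)
    have plus: "(\<lambda>x. \<xi> x + \<eta> x) \<in> dual" and minus: "(\<lambda>x. \<xi> x - \<eta> x) \<in> dual"
      by (auto intro!: dualI simp: dual_simps[OF \<xi>] dual_simps[OF \<eta>(1)] algebra_simps)
    have "0 = pfaffian (\<lambda>x. \<xi> x + \<eta> x) a b r s - pfaffian (\<lambda>x. \<xi> x - \<eta> x) a b r s"
      using pf[OF plus rs_H] pf[OF minus rs_H] by simp
    also have "\<dots> = 2 * (\<xi> (bracket a b) * \<eta> (bracket r s))"
      using rs rs0 by (simp add: pfaffian_def perp_def algebra_simps)
    finally show False using ab \<eta> char by simp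
  qed
qed

end

text \<open>The dimension theory of vector spaces is available for a chosen basis, here an arbitrary one.\<close>

sublocale finite_dimensional_lie_algebra \<subseteq>
  finite_dimensional_vector_space scale "SOME B. finite B \<and> independent B \<and> span B = UNIV"
proof -
  obtain C where C: "finite C" "span C = UNIV" using finite_dimensional by blast
  obtain B where B: "B \<subseteq> C" "independent B" "C \<subseteq> span B"
    using maximal_independent_subset[of C] by blast
  have "UNIV \<subseteq> span B" using C(2) B(3) span_minimal subspace_span by blast
  then have "\<exists>B. finite B \<and> independent B \<and> span B = UNIV"
    using B finite_subset[OF B(1) C(1)] by auto
  from someI_ex[OF this]
  show "finite_dimensional_vector_space scale
      (SOME B. finite B \<and> independent B \<and> span B = UNIV)"
    by unfold_locales auto
qed

context finite_dimensional_lie_algebra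
begin

lemma dim_perp:
  assumes \<xi>: "\<xi> \<in> dual" and H: "subspace H" and ab: "a \<in> H" "b \<in> H" "\<xi> (bracket a b) \<noteq> 0"
  shows "dim H = dim (perp \<xi> H a b) + 2"
proof -
  let ?P = "perp \<xi> H a b"
  let ?Q = "span (insert a ?P)"
  have P: "subspace ?P" by (rule subspace_perp[OF \<xi> H])
  have sP: "span ?P = ?P" using P by (simp add: span_eq_iff)
  have ba: "\<xi> (bracket b a) \<noteq> 0" using ab dual_bracket_antisym[OF \<xi>, of b a] by simp
  have "a \<notin> ?P" using ba by (auto simp: perp_def)
  moreover have "b \<notin> ?Q"
  proof
    assume "b \<in> ?Q"
    then obtain c where "b - c *s a \<in> ?P" by (auto simp: span_insert sP)
    then have "\<xi> (bracket a (b - c *s a)) = 0" by (simp add: perp_def)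
    then show False using ab \<xi> by (simp add: bracket_simps bracket_self dual_simps[OF \<xi>])
  qed
  ultimately have dim_Q: "dim (insert b ?Q) = dim ?P + 2"
    by (simp add: dim_insert_subspace P)
  have QH: "?Q \<subseteq> H"
    using H ab by (intro span_minimal) (auto simp: perp_def)
  then have "insert b ?Q \<subseteq> H" using ab by blast
  then have "dim ?P + 2 \<le> dim H" using dim_Q dim_subset by metis
  moreover have "H \<subseteq> span (insert b (insert a ?P))"
  proof
    fix z assume "z \<in> H"
    then obtain c d where "z - c *s a - d *s b \<in> ?P"
      using perp_complement[OF assms] by blast
    then have "z - d *s b - c *s a \<in> span ?P"
      by (simp add: sP algebra_simps)
    then show "z \<in> span (insert b (insert a ?P))"
      unfolding span_insert[of b] span_insert[of a] by blast
  qed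
  then have "dim H \<le> dim (insert b (insert a ?P))" by (metis dim_span dim_subset)
  then have "dim H \<le> dim ?P + 2" by (simp add: dim_insert split: if_splits)
  ultimately show ?thesis by simp
qed

text \<open>Splitting off hyperbolic planes lowers the dimension by 2 and keeps the radical, until the form
  vanishes.\<close>

lemma even_dim_minus_radical:
  assumes \<xi>: "\<xi> \<in> dual" and H: "subspace H"
  shows "dim (radical \<xi> H) \<le> dim H \<and> even (dim H - dim (radical \<xi> H))"
  using H
proof (induction "dim H" arbitrary: H rule: less_induct)
  case less
  show ?case
  proof (cases "\<forall>a\<in>H. \<forall>b\<in>H. \<xi> (bracket a b) = 0")
    case True
    then have "radical \<xi> H = H" by (auto simp: radical_def)
    then show ?thesis by simp
  next
    case False
    then obtain a b where ab: "a \<in> H" "b \<in> H" "\<xi> (bracket a b) \<noteq> 0" by blast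
    note d = dim_perp[OF \<xi> less.prems ab] and r = radical_perp[OF \<xi> less.prems ab]
    show ?thesis
      using less.hyps[of "perp \<xi> H a b"] subspace_perp[OF \<xi> less.prems, of a b]
      unfolding d r by auto
  qed
qed

lemma dim_radical_le:
  assumes \<xi>: "\<xi> \<in> dual" and H: "subspace H" and ab: "a \<in> H" "b \<in> H" "\<xi> (bracket a b) \<noteq> 0"
  shows "dim (radical \<xi> H) + 2 \<le> dim H"
  using even_dim_minus_radical[OF \<xi> subspace_perp[OF \<xi> H], of a b]
  unfolding dim_perp[OF assms] radical_perp[OF assms] by simp

text \<open>If \<open>\<xi>[a, b] \<noteq> 0\<close>, then the form restricted to the orthogonal space of \<open>a, b\<close> takes the value
  \<open>pfaffian \<xi> a b c d / \<xi>[a, b]\<close> on the projections of \<open>c, d\<close>. So two hyperbolic planes split off.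
  The remaining cases reduce to this one since the Pfaffian is alternating.\<close>

lemma dim_radical_le_if_pfaffian:
  assumes \<xi>: "\<xi> \<in> dual" and H: "subspace H" and mem: "{a, b, c, d} \<subseteq> H"
    and pf: "pfaffian \<xi> a b c d \<noteq> 0"
  shows "dim (radical \<xi> H) + 4 \<le> dim H"
proof -
  have main: "dim (radical \<xi> H) + 4 \<le> dim H"
    if mem: "{a, b, c, d} \<subseteq> H" and pf: "pfaffian \<xi> a b c d \<noteq> 0"
      and ab: "\<xi> (bracket a b) \<noteq> 0" for a b c d
  proof -
    have H_ab: "a \<in> H" "b \<in> H" using mem by auto
    let ?P = "perp \<xi> H a b"
    have "\<exists>r\<in>?P. \<exists>s\<in>?P. \<xi> (bracket r s) \<noteq> 0"
    proof (rule ccontr)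
      assume contra: "\<not> ?thesis"
      obtain p q where c: "c - p *s a - q *s b \<in> ?P"
        using perp_complement[OF \<xi> H H_ab ab] mem by blast
      obtain p' q' where d: "d - p' *s a - q' *s b \<in> ?P"
        using perp_complement[OF \<xi> H H_ab ab] mem by blast
      have anti: "\<xi> (bracket b a) = - \<xi> (bracket a b)" "\<xi> (bracket c a) = - \<xi> (bracket a c)"
        "\<xi> (bracket c b) = - \<xi> (bracket b c)"
        by (rule dual_bracket_antisym[OF \<xi>])+
      have "\<xi> (bracket (c - p *s a - q *s b) (d - p' *s a - q' *s b)) = 0"
        using contra c d by blast
      then have *: "\<xi> (bracket c d) - p * \<xi> (bracket a d) - q * \<xi> (bracket b d)
          + p' * \<xi> (bracket a c) + q' * \<xi> (bracket b c)
          + (p * q' - q * p') * \<xi> (bracket a b) = 0"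
        using \<xi> by (simp add: bracket_simps bracket_self dual_simps[OF \<xi>] anti algebra_simps)
      have "\<xi> (bracket a c) = q * \<xi> (bracket a b)" "\<xi> (bracket b c) = - p * \<xi> (bracket a b)"
        "\<xi> (bracket a d) = q' * \<xi> (bracket a b)" "\<xi> (bracket b d) = - p' * \<xi> (bracket a b)"
        using c d \<xi> by (simp_all add: perp_def bracket_simps bracket_self dual_simps[OF \<xi>] anti
            algebra_simps eq_neg_iff_add_eq_0)
      \<comment> \<open>These values make \<open>\<xi>[a, b]\<close> times the left side of the equation above the Pfaffian.\<close>
      then have "pfaffian \<xi> a b c d = 0"
        using * unfolding pfaffian_def by algebra
      then show False using pf by simp
    qed
    then obtain r s where rs: "r \<in> ?P" "s \<in> ?P" "\<xi> (bracket r s) \<noteq> 0" by blast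
    have "dim (radical \<xi> ?P) + 2 \<le> dim ?P"
      by (rule dim_radical_le[OF \<xi> subspace_perp[OF \<xi> H] rs])
    then show ?thesis
      unfolding radical_perp[OF \<xi> H H_ab ab] dim_perp[OF \<xi> H H_ab ab] by simp
  qed
  have anti: "\<xi> (bracket c b) = - \<xi> (bracket b c)" "\<xi> (bracket d c) = - \<xi> (bracket c d)"
      "\<xi> (bracket d b) = - \<xi> (bracket b d)"
    by (rule dual_bracket_antisym[OF \<xi>])+
  have "pfaffian \<xi> a c b d = - pfaffian \<xi> a b c d" "pfaffian \<xi> a d b c = pfaffian \<xi> a b c d"
    by (simp_all add: pfaffian_def anti algebra_simps)
  moreover have "\<xi> (bracket a b) \<noteq> 0 \<or> \<xi> (bracket a c) \<noteq> 0 \<or> \<xi> (bracket a d) \<noteq> 0"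
    using pf by (auto simp: pfaffian_def)
  ultimately show ?thesis
    using main[of a b c d] main[of a c b d] main[of a d b c] mem pf by auto
qed

section \<open>Index and abelian subalgebras\<close>

lemma index_le: "\<xi> \<in> dual \<Longrightarrow> index \<le> dim (stabilizer \<xi>)"
  unfolding index_def using finite_stabilizer_dims by (intro Min_le) auto

lemma index_attained: obtains \<xi> where "\<xi> \<in> dual" "dim (stabilizer \<xi>) = index"
proof -
  have "index \<in> (\<lambda>\<xi>. dim (stabilizer \<xi>)) ` dual"
    unfolding index_def using finite_stabilizer_dims dual_nonempty by (intro Min_in) auto
  then show thesis using that by force
qed

lemma even_dim_minus_index: "index \<le> dim UNIV \<and> even (dim UNIV - index)"
proof -
  obtain \<xi> where \<xi>: "\<xi> \<in> dual" "dim (stabilizer \<xi>) = index" by (rule index_attained)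
  show ?thesis
    using even_dim_minus_radical[OF \<xi>(1) subspace_UNIV] \<xi>(2)
    unfolding stabilizer_eq_radical by (simp del: even_diff_nat)
qed

lemma dim_le_max_abelian_dim:
  assumes "subspace A" "abelian A"
  shows "dim A \<le> max_abelian_dim"
proof -
  have "subalgebra A" using assms by (auto simp: subalgebra_def abelian_def subspace_0)
  then show ?thesis
    unfolding max_abelian_dim_def using assms finite_abelian_dims by (intro Max_ge) auto
qed

lemma abelian_span:
  assumes "\<And>x y. x \<in> S \<Longrightarrow> y \<in> S \<Longrightarrow> bracket x y = 0"
  shows "abelian (span S)"
proof -
  have 1: "bracket x y = 0" if "x \<in> span S" "y \<in> S" for x y
  proof -
    have "span S \<subseteq> {x. bracket x y = 0}"
      using assms that by (intro span_minimal) (auto simp: subspace_def bracket_simps)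
    then show ?thesis using that by auto
  qed
  have "span S \<subseteq> {y. bracket x y = 0}" if "x \<in> span S" for x
    using 1 that by (intro span_minimal) (auto simp: subspace_def bracket_simps)
  then show ?thesis by (auto simp: abelian_def)
qed

text \<open>Vanishing Pfaffians say that all forms have rank at most 2 on \<open>H\<close>, so the orthogonal space of
  any pair \<open>a, b\<close> with \<open>\<xi>[a, b] \<noteq> 0\<close> is a radical, of codimension 2, and abelian.\<close>

lemma dim_minus_2_le_max_abelian_dim:
  assumes char: "(2 :: 'a) \<noteq> 0" and H: "subspace H"
    and pf: "\<And>\<xi> a b c d. \<xi> \<in> dual \<Longrightarrow> {a, b, c, d} \<subseteq> H \<Longrightarrow> pfaffian \<xi> a b c d = 0"
  shows "dim H \<le> max_abelian_dim + 2"
proof (cases "abelian H")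
  case True
  then show ?thesis using dim_le_max_abelian_dim[OF H] by simp
next
  case False
  then obtain a b where ab: "a \<in> H" "b \<in> H" "bracket a b \<noteq> 0" by (auto simp: abelian_def)
  obtain \<xi> where \<xi>: "\<xi> \<in> dual" "\<xi> (bracket a b) \<noteq> 0" using ab(3) by (rule dual_separates)
  have "abelian (perp \<xi> H a b)"
    by (rule abelian_perp_if_pfaffians_vanish[OF char \<xi>(1) H ab(1,2) \<xi>(2) pf])
  then show ?thesis
    using dim_le_max_abelian_dim[OF subspace_perp[OF \<xi>(1) H]]
      dim_perp[OF \<xi>(1) H ab(1,2) \<xi>(2)] by simp
qed

lemma index_plus_2_le:
  assumes "\<not> abelian UNIV"
  shows "index + 2 \<le> dim UNIV"
proof -
  obtain a b where "bracket a b \<noteq> 0" using assms by (auto simp: abelian_def)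
  then obtain \<xi> where \<xi>: "\<xi> \<in> dual" "\<xi> (bracket a b) \<noteq> 0" by (rule dual_separates)
  then have "dim (stabilizer \<xi>) + 2 \<le> dim UNIV"
    using dim_radical_le[OF \<xi>(1) subspace_UNIV _ _ \<xi>(2)] by (simp add: stabilizer_eq_radical)
  then show ?thesis using index_le[OF \<xi>(1)] by linarith
qed

lemma stabilizer_dim_if_pfaffian:
  assumes "\<xi> \<in> dual" "pfaffian \<xi> a b c d \<noteq> 0"
  shows "dim (stabilizer \<xi>) + 4 \<le> dim UNIV"
  using dim_radical_le_if_pfaffian[OF assms(1) subspace_UNIV _ assms(2)]
  by (simp add: stabilizer_eq_radical)

text \<open>The index hypothesis says that regular functionals are those whose form has rank 4, which is the
  largest possible rank. A functional with a nonzero Pfaffian is therefore regular, and its stabilizer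
  lies in the Frobenius semiradical; in a hyperplane containing the semiradical this leaves no room
  for rank 4.\<close>

lemma max_abelian_dim_if_not_quasi_quadratic:
  assumes char: "(2 :: 'a) \<noteq> 0" and index: "index + 4 = dim UNIV" and nqq: "\<not> quasi_quadratic"
  shows "index + 1 \<le> max_abelian_dim"
proof -
  have "subspace frobenius_semiradical" by (simp add: frobenius_semiradical_def)
  then obtain H where H: "subspace H" "frobenius_semiradical \<subseteq> H" "dim H + 1 = dim UNIV"
    using proper_subspace_in_hyperplane nqq unfolding quasi_quadratic_def by metis
  have "dim H \<le> max_abelian_dim + 2"
  proof (rule dim_minus_2_le_max_abelian_dim[OF char H(1)], rule ccontr)
    fix \<xi> a b c d
    assume \<xi>: "\<xi> \<in> dual" and mem: "{a, b, c, d} \<subseteq> H" and pf: "pfaffian \<xi> a b c d \<noteq> 0"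
    have stab: "dim (stabilizer \<xi>) = index"
      using stabilizer_dim_if_pfaffian[OF \<xi> pf] index_le[OF \<xi>] index by linarith
    then have "stabilizer \<xi> \<subseteq> frobenius_semiradical"
      unfolding frobenius_semiradical_def regular_def using \<xi> by (auto intro: span_base)
    then have "stabilizer \<xi> \<subseteq> radical \<xi> H"
      using H(2) by (intro stabilizer_subset_radical) blast
    then have "index \<le> dim (radical \<xi> H)" using dim_subset stab by metis
    then show False
      using dim_radical_le_if_pfaffian[OF \<xi> H(1) mem pf] H(3) index by linarith
  qed
  then show ?thesis using H(3) index by linarith
qed

end

section \<open>Common eigenvectors of a solvable Lie algebra\<close>

context lie_algebra
begin

definition ideal :: "'v set \<Rightarrow> bool" where
  "ideal K \<longleftrightarrow> subspace K \<and> (\<forall>x. \<forall>k\<in>K. bracket x k \<in> K)"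

text \<open>The class of \<open>y\<close> modulo \<open>K\<close> is a common eigenvector of the operators \<open>[a, -]\<close> with \<open>a \<in> A\<close>.\<close>

definition eigenvector_mod :: "'v set \<Rightarrow> 'v set \<Rightarrow> 'v \<Rightarrow> bool" where
  "eigenvector_mod K A y \<longleftrightarrow> (\<forall>a\<in>A. \<exists>c. bracket a y - c *s y \<in> K)"

lemma eigenvector_mod_span:
  assumes K: "subspace K" and y: "eigenvector_mod K A y"
  shows "eigenvector_mod K (span A) y"
proof -
  have "span A \<subseteq> {a. \<exists>c. bracket a y - c *s y \<in> K}"
  proof (rule span_minimal)
    show "A \<subseteq> {a. \<exists>c. bracket a y - c *s y \<in> K}"
      using y by (auto simp: eigenvector_mod_def)
    show "subspace {a. \<exists>c. bracket a y - c *s y \<in> K}"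
    proof (rule subspaceI)
      show "0 \<in> {a. \<exists>c. bracket a y - c *s y \<in> K}"
        using K by (intro CollectI exI[of _ 0]) (simp add: bracket_simps subspace_0)
    next
      fix a b assume "a \<in> {a. \<exists>c. bracket a y - c *s y \<in> K}" "b \<in> {a. \<exists>c. bracket a y - c *s y \<in> K}"
      then obtain c d where "bracket a y - c *s y \<in> K" "bracket b y - d *s y \<in> K" by blast
      from subspace_add[OF K this] have "bracket (a + b) y - (c + d) *s y \<in> K"
        by (simp add: bracket_simps algebra_simps)
      then show "a + b \<in> {a. \<exists>c. bracket a y - c *s y \<in> K}" by blast
    next
      fix e a assume "a \<in> {a. \<exists>c. bracket a y - c *s y \<in> K}"
      then obtain c where "bracket a y - c *s y \<in> K" by blast
      then have "e *s (bracket a y - c *s y) \<in> K" using K subspace_scale by blast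
      then have "bracket (e *s a) y - (e * c) *s y \<in> K"
        by (simp add: bracket_simps scale_right_diff_distrib)
      then show "e *s a \<in> {a. \<exists>c. bracket a y - c *s y \<in> K}" by blast
    qed
  qed
  then show ?thesis by (auto simp: eigenvector_mod_def)
qed

lemma subspace_derived_series: "subspace (derived_series n)"
  by (cases n) (simp_all only: derived_series.simps subspace_UNIV subspace_span)

lemma derived_series_Suc_subset: "derived_series (Suc n) \<subseteq> derived_series n"
proof (induction n)
  case (Suc n)
  have "{bracket x y |x y. x \<in> derived_series (Suc n) \<and> y \<in> derived_series (Suc n)}
     \<subseteq> {bracket x y |x y. x \<in> derived_series n \<and> y \<in> derived_series n}"
    using Suc by blast
  then show ?case
    unfolding derived_series.simps(2)[of "Suc n"] derived_series.simps(2)[of n] by (rule span_mono)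
qed simp

lemma bracket_in_derived_series:
  "x \<in> derived_series n \<Longrightarrow> y \<in> derived_series n \<Longrightarrow> bracket x y \<in> derived_series (Suc n)"
  unfolding derived_series.simps(2) by (rule span_base) blast

end

context finite_dimensional_lie_algebra
begin

text \<open>Write \<open>u\<^sub>j = [z, -]\<^sup>j y\<close>. Modulo \<open>K\<close> and earlier iterates, each \<open>a\<close> acts on \<open>u\<^sub>j\<close> by \<open>\<nu>(a)\<close>, and the
  leading correction is \<open>j \<nu>([a, z]) u\<^bsub>j-1\<^esub>\<close>, because each of the \<open>j\<close> factors \<open>z\<close> that \<open>a\<close> moves past
  contributes one commutator \<open>[a, z]\<close>. For \<open>j = 0\<close> the truncated index \<open>j - 1\<close> is harmless, as its
  coefficient is zero.\<close>

lemma bracket_iterate_triangular: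
  assumes K: "ideal K"
    and A: "\<And>a. a \<in> A \<Longrightarrow> bracket a z \<in> A"
    and \<nu>: "\<And>a. a \<in> A \<Longrightarrow> bracket a y - \<nu> a *s y \<in> K"
    and a: "a \<in> A"
  shows "bracket a ((bracket z ^^ j) y) - \<nu> a *s (bracket z ^^ j) y
      - (of_nat j * \<nu> (bracket a z)) *s (bracket z ^^ (j - 1)) y \<in> krylov (bracket z) K y (j - 1)"
  using a
proof (induction j arbitrary: a)
  case 0
  then have "bracket a y - \<nu> a *s y \<in> krylov (bracket z) K y 0"
    using \<nu> krylov_base by blast
  then show ?case by simp
next
  case (Suc j)
  let ?u = "\<lambda>j. (bracket z ^^ j) y" and ?W = "krylov (bracket z) K y"
  let ?l = "\<nu> (bracket a z)"
  define r where "r = bracket a (?u j) - \<nu> a *s ?u j - (of_nat j * ?l) *s ?u (j - 1)"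
  define s where "s = bracket (bracket a z) (?u j) - ?l *s ?u j"
  have "s - (of_nat j * \<nu> (bracket (bracket a z) z)) *s ?u (j - 1) \<in> ?W (j - 1)"
    unfolding s_def by (rule Suc.IH[OF A[OF Suc.prems]])
  then have "s - (of_nat j * \<nu> (bracket (bracket a z) z)) *s ?u (j - 1) \<in> ?W j"
    using krylov_mono[of "j - 1" j] by auto
  moreover have "(of_nat j * \<nu> (bracket (bracket a z) z)) *s ?u (j - 1) \<in> ?W j"
  proof (cases j)
    case (Suc i)
    then show ?thesis
      using iterate_in_krylov[of i j] by (auto intro: subspace_scale[OF subspace_krylov])
  qed (simp add: subspace_0 subspace_krylov)
  ultimately have s: "s \<in> ?W j"
    by (metis diff_add_cancel subspace_add subspace_krylov)
  have r: "r \<in> ?W (j - 1)" unfolding r_def by (rule Suc.IH[OF Suc.prems])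
  have stable: "\<And>k. k \<in> K \<Longrightarrow> bracket z k \<in> K" using K by (auto simp: ideal_def)
  have zr: "bracket z r \<in> ?W j"
  proof (cases j)
    case 0
    then show ?thesis
      using r stable K krylov_0 by (auto simp: ideal_def)
  next
    case (Suc i)
    then show ?thesis
      using krylov_shift[OF linear_bracket_right stable r] by simp
  qed
  have shift: "(of_nat j * ?l) *s bracket z (?u (j - 1)) = (of_nat j * ?l) *s ?u j"
    by (cases j) simp_all
  have zr_eq: "bracket z r = bracket z (bracket a (?u j)) - \<nu> a *s bracket z (?u j)
      - (of_nat j * ?l) *s ?u j"
    unfolding r_def by (simp only: bracket_right_simps shift)
  have "bracket a (?u (Suc j)) - \<nu> a *s ?u (Suc j) - (of_nat (Suc j) * ?l) *s ?u j
      = s + bracket z r"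
    by (simp add: s_def zr_eq bracket_leibniz[of a z "?u j"] algebra_simps)
  also have "\<dots> \<in> ?W j" using s zr by (rule subspace_add[OF subspace_krylov])
  finally show ?case by simp
qed

end

locale alg_closed_lie_algebra = finite_dimensional_lie_algebra scale bracket
  for scale :: "'k::{alg_closed_field, field_char_0} \<Rightarrow> 'v::ab_group_add \<Rightarrow> 'v" (infixr "*s" 75)
    and bracket :: "'v \<Rightarrow> 'v \<Rightarrow> 'v"
begin

sublocale alg_closed_finite_dimensional_space scale
  "SOME B. finite B \<and> independent B \<and> span B = UNIV"
  by unfold_locales

text \<open>Let \<open>u\<^sub>n\<close> be the first iterate that depends on the earlier ones modulo \<open>K\<close>. By triangularity
  \<open>a - \<nu>(a)\<close> maps the span of \<open>K\<close> and \<open>u\<^sub>0, \<dots>, u\<^bsub>n-1\<^esub>\<close>, which contains \<open>u\<^sub>n\<close>, into the span of \<open>K\<close>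
  and \<open>u\<^sub>0, \<dots>, u\<^bsub>n-2\<^esub>\<close>. On \<open>u\<^sub>n\<close> itself its leading term is \<open>n \<nu>([a, z]) u\<^bsub>n-1\<^esub>\<close>, so that
  \<open>n \<nu>([a, z]) = 0\<close>, and \<open>n\<close> is invertible in characteristic zero. This replaces the usual
  trace computation.\<close>

lemma weight_vanishes_on_brackets:
  assumes K: "ideal K"
    and A: "\<And>a. a \<in> A \<Longrightarrow> bracket a z \<in> A"
    and \<nu>: "\<And>a. a \<in> A \<Longrightarrow> bracket a y - \<nu> a *s y \<in> K"
    and y: "y \<notin> K" and a: "a \<in> A"
  shows "\<nu> (bracket a z) = 0"
proof -
  let ?u = "\<lambda>j. (bracket z ^^ j) y" and ?W = "krylov (bracket z) K y"
  have sub_K: "subspace K" using K by (simp add: ideal_def)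
  note W = subspace_krylov
  define n where "n = (LEAST n. ?u n \<in> ?W n)"
  have n: "?u n \<in> ?W n" unfolding n_def using krylov_stops by (rule LeastI_ex)
  have least: "?u m \<notin> ?W m" if "m < n" for m
    using that unfolding n_def by (rule not_less_Least)
  have "n \<noteq> 0" using n y krylov_0[OF sub_K] by (metis funpow_0)
  then obtain m where m: "n = Suc m" using not0_implies_Suc by blast
  have tri: "bracket a (?u j) - \<nu> a *s ?u j - (of_nat j * \<nu> (bracket a z)) *s ?u (j - 1) \<in> ?W (j - 1)"
    for j by (rule bracket_iterate_triangular[OF K A \<nu> a])
  have diag: "bracket a (?u j) - \<nu> a *s ?u j \<in> ?W m" if "j \<le> m" for j
  proof -
    have low: "(of_nat j * \<nu> (bracket a z)) *s ?u (j - 1) \<in> ?W m"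
    proof (cases j)
      case (Suc i)
      then show ?thesis
        using iterate_in_krylov[of i m] that by (auto intro: subspace_scale[OF W])
    qed (simp add: subspace_0[OF W])
    have "?W (j - 1) \<subseteq> ?W m" using that by (intro krylov_mono) simp
    from subspace_add[OF W subsetD[OF this tri[of j]] low] show ?thesis by simp
  qed
  have "?W n \<subseteq> {v. bracket a v - \<nu> a *s v \<in> ?W m}"
    unfolding krylov_def[of _ _ _ n]
  proof (rule span_minimal)
    have "bracket a k - \<nu> a *s k \<in> ?W m" if "k \<in> K" for k
    proof -
      have "bracket a k - \<nu> a *s k \<in> K"
        using that K by (simp add: ideal_def subspace_diff subspace_scale)
      then show ?thesis by (rule subsetD[OF krylov_base])
    qed
    then show "K \<union> ?u ` {..<n} \<subseteq> {v. bracket a v - \<nu> a *s v \<in> ?W m}"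
      using diag m by auto
    show "subspace {v. bracket a v - \<nu> a *s v \<in> ?W m}"
      unfolding subspace_def mem_Collect_eq
    proof (intro conjI ballI allI)
      show "bracket a 0 - \<nu> a *s 0 \<in> ?W m" by (simp add: bracket_simps subspace_0[OF W])
    next
      fix v w
      assume "v \<in> {v. bracket a v - \<nu> a *s v \<in> ?W m}" "w \<in> {v. bracket a v - \<nu> a *s v \<in> ?W m}"
      then have "bracket a v - \<nu> a *s v \<in> ?W m" "bracket a w - \<nu> a *s w \<in> ?W m" by simp_all
      from subspace_add[OF W this] show "bracket a (v + w) - \<nu> a *s (v + w) \<in> ?W m"
        by (simp add: bracket_simps algebra_simps)
    next
      fix c v
      assume "v \<in> {v. bracket a v - \<nu> a *s v \<in> ?W m}"
      then have "bracket a v - \<nu> a *s v \<in> ?W m" by simp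
      from subspace_scale[OF W this, of c] show "bracket a (c *s v) - \<nu> a *s (c *s v) \<in> ?W m"
        by (simp add: bracket_simps scale_right_diff_distrib mult.commute)
    qed
  qed
  then have "bracket a (?u n) - \<nu> a *s ?u n \<in> ?W m" using n by blast
  from subspace_diff[OF W this tri[of n, unfolded m diff_Suc_1]]
  have *: "(of_nat n * \<nu> (bracket a z)) *s ?u m \<in> ?W m" by (simp add: m)
  show ?thesis
  proof (rule ccontr)
    assume "\<nu> (bracket a z) \<noteq> 0"
    then have ne: "of_nat n * \<nu> (bracket a z) \<noteq> 0" using \<open>n \<noteq> 0\<close> by simp
    have "?u m \<in> ?W m"
      using subspace_scale[OF W *, of "1 / (of_nat n * \<nu> (bracket a z))"] ne by simp
    then show False using least m by blast
  qed
qed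

text \<open>Since the weight \<open>\<nu>\<close> vanishes on the brackets \<open>[a, z]\<close>, the weight space of \<open>\<nu>\<close> is stable under
  \<open>z\<close>, and \<open>z\<close> has an eigenvector in it.\<close>

lemma extend_eigenvector:
  assumes K: "ideal K" and M: "ideal M"
    and A: "\<And>a. a \<in> A \<Longrightarrow> bracket a z \<in> A"
    and y: "y \<in> M - K" "eigenvector_mod K A y"
  shows "\<exists>w \<in> M - K. eigenvector_mod K (insert z A) w"
proof -
  have sub: "subspace K" "subspace M" using K M by (auto simp: ideal_def)
  obtain \<nu> where \<nu>: "\<And>a. a \<in> A \<Longrightarrow> bracket a y - \<nu> a *s y \<in> K"
    using y(2) unfolding eigenvector_mod_def by metis
  define N where "N = {v \<in> M. \<forall>a\<in>A. bracket a v - \<nu> a *s v \<in> K}"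
  have "subspace N"
  proof (rule subspaceI)
    show "0 \<in> N" using sub by (auto simp: N_def bracket_simps subspace_0)
  next
    fix v w assume vw: "v \<in> N" "w \<in> N"
    have "bracket a (v + w) - \<nu> a *s (v + w) \<in> K" if "a \<in> A" for a
      using subspace_add[OF sub(1), of "bracket a v - \<nu> a *s v" "bracket a w - \<nu> a *s w"] vw that
      by (simp add: N_def bracket_simps algebra_simps)
    then show "v + w \<in> N" using vw sub by (simp add: N_def subspace_add)
  next
    fix c v assume v: "v \<in> N"
    have "bracket a (c *s v) - \<nu> a *s (c *s v) \<in> K" if "a \<in> A" for a
      using subspace_scale[OF sub(1), of "bracket a v - \<nu> a *s v" c] v that
      by (simp add: N_def bracket_simps scale_right_diff_distrib mult.commute)
    then show "c *s v \<in> N" using v sub by (simp add: N_def subspace_scale)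
  qed
  moreover have "bracket z v \<in> N" if v: "v \<in> N" for v
  proof -
    have "bracket a (bracket z v) - \<nu> a *s bracket z v \<in> K" if a: "a \<in> A" for a
    proof -
      have "\<nu> (bracket a z) = 0"
        using weight_vanishes_on_brackets[OF K A \<nu> _ a] y(1) by blast
      then have "bracket (bracket a z) v \<in> K"
        using v A[OF a] by (force simp: N_def)
      moreover have "bracket z (bracket a v - \<nu> a *s v) \<in> K"
        using v a K by (auto simp: N_def ideal_def)
      ultimately have "bracket (bracket a z) v + bracket z (bracket a v - \<nu> a *s v) \<in> K"
        by (rule subspace_add[OF sub(1)])
      then show ?thesis by (simp add: bracket_leibniz[of a z v] bracket_simps algebra_simps)
    qed
    then show ?thesis using v M by (auto simp: N_def ideal_def)
  qed
  moreover have "y \<in> N" using y(1) \<nu> by (simp add: N_def)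
  ultimately obtain w where w: "w \<in> N - K" "\<exists>\<mu>. bracket z w - \<mu> *s w \<in> K"
    using eigenvector_modulo_subspace[OF linear_bracket_right sub(1)] y(1) by blast
  then have "eigenvector_mod K (insert z A) w" by (auto simp: eigenvector_mod_def N_def)
  then show ?thesis using w(1) by (auto simp: N_def)
qed

text \<open>Any subspace between two consecutive terms of the derived series is stable under brackets with the
  larger term. So one can pass from the smaller term to the larger one by adding basis vectors one
  at a time.\<close>

lemma eigenvector_for_derived_series:
  assumes K: "ideal K" and M: "ideal M"
    and ex: "\<exists>y \<in> M - K. eigenvector_mod K (derived_series (Suc n)) y"
  shows "\<exists>y \<in> M - K. eigenvector_mod K (derived_series n) y"
proof -
  let ?D = "derived_series n" and ?D' = "derived_series (Suc n)"
  have sub_K: "subspace K" using K by (simp add: ideal_def)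
  have DD: "?D' \<subseteq> ?D" by (rule derived_series_Suc_subset)
  obtain F where F: "F \<subseteq> ?D" "independent F" "?D \<subseteq> span F"
    using basis_exists[of ?D] by metis
  have "\<exists>y \<in> M - K. eigenvector_mod K (span (?D' \<union> G)) y" if "G \<subseteq> ?D" "finite G" for G
    using that(2,1)
  proof (induction G rule: finite_induct)
    case empty
    then show ?case using ex eigenvector_mod_span[OF sub_K] by auto
  next
    case (insert z G)
    let ?A = "span (?D' \<union> G)"
    have "?A \<subseteq> ?D"
      using insert.prems DD by (intro span_minimal) (auto simp del: derived_series.simps simp: subspace_derived_series)
    then have closed: "bracket a z \<in> ?A" if "a \<in> ?A" for a
      using bracket_in_derived_series[of a n z] that insert.prems
      by (intro span_base) (auto simp del: derived_series.simps)
    obtain y where "y \<in> M - K" "eigenvector_mod K ?A y" using insert by auto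
    then obtain w where w: "w \<in> M - K" "eigenvector_mod K (insert z ?A) w"
      using extend_eigenvector[OF K M closed] by blast
    have "eigenvector_mod K (?D' \<union> insert z G) w"
      using w(2) span_base[of _ "?D' \<union> G"] unfolding eigenvector_mod_def by blast
    then show ?case using w(1) eigenvector_mod_span[OF sub_K] by blast
  qed
  from this[OF F(1) finiteI_independent[OF F(2)]]
  obtain y where y: "y \<in> M - K" "eigenvector_mod K (span (?D' \<union> F)) y" by blast
  have "?D \<subseteq> span (?D' \<union> F)" using F(3) span_mono[of F "?D' \<union> F"] by blast
  then show ?thesis using y unfolding eigenvector_mod_def by blast
qed

text \<open>Lie's theorem for the action of \<open>L\<close> on the quotient of an ideal \<open>M\<close> by an ideal \<open>K\<close>.\<close>

theorem lie_theorem_modulo_ideal: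
  assumes solvable and K: "ideal K" and M: "ideal M" and KM: "\<not> M \<subseteq> K"
  shows "\<exists>y \<in> M - K. \<forall>z. \<exists>c. bracket z y - c *s y \<in> K"
proof -
  obtain n where n: "derived_series n = {0}" using assms by (auto simp: solvable_def)
  have "0 \<in> K" using K by (simp add: ideal_def subspace_0)
  then have "eigenvector_mod K (derived_series n) y" for y
    unfolding n eigenvector_mod_def by (intro ballI exI[of _ 0]) (simp add: bracket_simps)
  then have "\<exists>y \<in> M - K. eigenvector_mod K (derived_series n) y" using KM by blast
  then have "\<exists>y \<in> M - K. eigenvector_mod K (derived_series 0) y"
  proof (induction n)
    case (Suc n)
    show ?case by (rule Suc.IH[OF eigenvector_for_derived_series[OF K M Suc.prems]])
  qed
  then show ?thesis by (simp add: eigenvector_mod_def)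
qed

text \<open>First \<open>x\<close> is a common eigenvector in \<open>L\<close>. Its centralizer is then an ideal of codimension at most
  1 that properly contains the line of \<open>x\<close>, and \<open>y\<close> is a common eigenvector in the quotient.\<close>

lemma commuting_flag:
  assumes solvable and n: "dim UNIV \<ge> 3"
  obtains x y where "x \<noteq> 0" "y \<notin> span {x}" "bracket x y = 0"
    "dim UNIV \<le> dim {z. bracket z x = 0} + 1"
    "\<And>z. \<exists>c. bracket z y - c *s y \<in> span {x}"
proof -
  have ideals: "ideal {0}" "ideal UNIV" by (simp_all add: ideal_def bracket_simps)
  have nontrivial: "\<not> UNIV \<subseteq> ({0} :: 'v set)"
  proof
    assume "UNIV \<subseteq> ({0} :: 'v set)"
    then have "dim UNIV = 0" by (rule dim_eq_0[THEN iffD2])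
    then show False using n by linarith
  qed
  obtain x where x: "x \<notin> {0}" "\<And>z. \<exists>c. bracket z x - c *s x \<in> {0}"
    using lie_theorem_modulo_ideal[OF assms(1) ideals nontrivial] by blast
  let ?C = "{z. bracket z x = 0}"
  have C: "subspace ?C" by (auto simp: subspace_def bracket_simps)
  have codim: "dim UNIV \<le> dim ?C + 1"
    using dim_le_Suc_if_image_modulo_line[OF linear_bracket_left subspace_single_0 subspace_UNIV x(2)]
    by (simp del: dim_UNIV)
  have x': "\<exists>c. bracket z x = c *s x" for z using x(2)[of z] by auto
  have "bracket z k \<in> span {x}" if k: "k \<in> span {x}" for z k
  proof -
    obtain c where "bracket z x = c *s x" using x' by blast
    moreover obtain d where "k = d *s x" using k by (auto simp: span_singleton)
    ultimately have "bracket z k = (d * c) *s x" by (simp add: bracket_simps)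
    then show ?thesis by (simp add: span_base subspace_scale)
  qed
  then have X: "ideal (span {x})" by (auto simp: ideal_def)
  have "bracket z k \<in> ?C" if "k \<in> ?C" for z k
  proof -
    obtain c where "bracket z x = c *s x" using x' by blast
    moreover have "bracket k x = 0" using that by simp
    moreover have "bracket (bracket z k) x = bracket z (bracket k x) - bracket k (bracket z x)"
      using bracket_leibniz[of z k x] by simp
    ultimately show ?thesis by (simp add: bracket_simps)
  qed
  then have C_ideal: "ideal ?C" using C by (simp add: ideal_def)
  have "dim (span {x}) \<le> 1" by simp
  then have big: "\<not> ?C \<subseteq> span {x}" using codim n dim_subset[of ?C "span {x}"] by linarith
  obtain y where y: "y \<in> ?C" "y \<notin> span {x}"
    and ev: "\<And>z. \<exists>c. bracket z y - c *s y \<in> span {x}"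
    using lie_theorem_modulo_ideal[OF assms(1) X C_ideal big] by blast
  have "bracket x y = 0" using y(1) bracket_antisym[of x y] by simp
  then show thesis using x(1) by (intro that[of x y, OF _ y(2) _ codim ev]) simp_all
qed

lemma max_abelian_dim_ge_2:
  assumes solvable and n: "dim UNIV \<ge> 3"
  shows "max_abelian_dim \<ge> 2"
proof -
  obtain x y where xy: "x \<noteq> 0" "y \<notin> span {x}" "bracket x y = 0"
    using commuting_flag[OF assms] by metis
  have "abelian (span {y, x})"
    using xy(3) bracket_antisym[of y x] by (intro abelian_span) (auto simp: bracket_self)
  moreover have "dim (span {y, x}) = 2" using xy by (simp add: dim_insert)
  ultimately show ?thesis using dim_le_max_abelian_dim[OF subspace_span] by metis
qed

text \<open>Inside the centralizer of \<open>x\<close>, commuting with \<open>y\<close> costs two more dimensions: one for the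
  eigenvalue of \<open>y\<close> modulo \<open>x\<close> and one for the coefficient at \<open>x\<close>. The joint centralizer has
  dimension at least \<open>6 - 3\<close>, so it is larger than the span of \<open>x\<close> and \<open>y\<close>.\<close>

lemma max_abelian_dim_ge_3:
  assumes solvable and n: "dim UNIV \<ge> 6"
  shows "max_abelian_dim \<ge> 3"
proof -
  have "dim UNIV \<ge> 3" using n by linarith
  obtain x y where x: "x \<noteq> 0" and y: "y \<notin> span {x}" and xy: "bracket x y = 0"
    and codim: "dim UNIV \<le> dim {z. bracket z x = 0} + 1"
    and ev: "\<And>z. \<exists>c. bracket z y - c *s y \<in> span {x}"
    using commuting_flag[OF assms(1) \<open>dim UNIV \<ge> 3\<close>] by blast
  let ?C = "{z. bracket z x = 0}"
  let ?D = "{z \<in> ?C. bracket z y \<in> span {x}}"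
  let ?E = "{z \<in> ?D. bracket z y \<in> {0}}"
  have C: "subspace ?C" by (auto simp: subspace_def bracket_simps)
  have D: "subspace ?D"
    using C subspace_span[of "{x}"] by (auto simp: subspace_def bracket_simps)
  have "dim ?C \<le> dim ?D + 1"
    by (rule dim_le_Suc_if_image_modulo_line[OF linear_bracket_left subspace_span C ev])
  moreover have "dim ?D \<le> dim ?E + 1"
    by (rule dim_le_Suc_if_image_modulo_line[OF linear_bracket_left subspace_single_0 D, of _ x])
       (auto simp: span_singleton)
  ultimately have E: "dim ?E \<ge> 3" using codim n by linarith
  have dim_yx: "dim (span {y, x}) = 2" using x y by (simp add: dim_insert)
  then have "\<not> ?E \<subseteq> span {y, x}" using E dim_subset[of ?E "span {y, x}"] by linarith
  then obtain w where w: "w \<notin> span {y, x}" "bracket w x = 0" "bracket w y = 0" by auto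
  have "abelian (span {w, y, x})"
    using w xy bracket_antisym[of y x] bracket_antisym[of x w] bracket_antisym[of y w]
    by (intro abelian_span) (auto simp: bracket_self)
  moreover have "dim (span {w, y, x}) = 3" using w(1) dim_yx by (simp add: dim_insert)
  ultimately show ?thesis using dim_le_max_abelian_dim[OF subspace_span] by metis
qed

lemma dim_le_max_abelian_dim_plus_3:
  assumes solvable and n: "dim UNIV \<le> 6"
  shows "dim UNIV \<le> max_abelian_dim + 3"
proof -
  consider "dim UNIV \<le> 3" | "dim UNIV = 4 \<or> dim UNIV = 5" | "dim UNIV = 6" using n by linarith
  then show ?thesis
    using max_abelian_dim_ge_2[OF assms(1)] max_abelian_dim_ge_3[OF assms(1)] by cases linarith+
qed

section \<open>Rentschler's property\<close>

lemma rentschler_propertyI: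
  assumes "dim UNIV + index \<le> 2 * max_abelian_dim + 2"
  shows rentschler_property
proof -
  have "real (dim UNIV) + real index \<le> 2 * real max_abelian_dim + 2"
    using of_nat_mono[OF assms, where 'a = real] by (simp del: dim_UNIV)
  then show ?thesis
    unfolding rentschler_property_def magic_number_def by (simp del: dim_UNIV add: field_simps)
qed

text \<open>If every form has rank at most 2, there is an abelian subspace of codimension 2, or \<open>L\<close> is
  abelian; otherwise some form has rank at least 4.\<close>

lemma rentschler_or_index_plus_4_le:
  "rentschler_property \<or> index + 4 \<le> dim UNIV"
proof (cases "abelian UNIV")
  case True
  then have "dim UNIV \<le> max_abelian_dim" by (rule dim_le_max_abelian_dim[OF subspace_UNIV])
  then show ?thesis using even_dim_minus_index by (intro disjI1 rentschler_propertyI) linarith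
next
  case False
  show ?thesis
  proof (cases "\<exists>\<xi>\<in>dual. \<exists>a b c d. pfaffian \<xi> a b c d \<noteq> 0")
    case True
    then obtain \<xi> a b c d where \<xi>: "\<xi> \<in> dual" "pfaffian \<xi> a b c d \<noteq> 0" by blast
    then show ?thesis using stabilizer_dim_if_pfaffian[OF \<xi>] index_le[OF \<xi>(1)] by linarith
  next
    case nz: False
    then have "dim UNIV \<le> max_abelian_dim + 2"
      by (intro dim_minus_2_le_max_abelian_dim) auto
    then show ?thesis
      using index_plus_2_le[OF False] by (intro disjI1 rentschler_propertyI) linarith
  qed
qed

lemma rentschler_dim_le_6:
  assumes solvable "dim UNIV \<le> 6"
  shows rentschler_property
  using rentschler_or_index_plus_4_le
proof
  assume "index + 4 \<le> dim UNIV"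
  with dim_le_max_abelian_dim_plus_3[OF assms] show ?thesis
    by (intro rentschler_propertyI) linarith
qed

text \<open>A counterexample would have index at most 3. Index at most 1 is covered by the commuting triple,
  and 2 has the wrong parity.\<close>

lemma rentschler_dim_7:
  assumes solvable and n: "dim UNIV = 7" and index: "index \<noteq> 3 \<or> \<not> quasi_quadratic"
  shows rentschler_property
proof (rule ccontr)
  assume no: "\<not> rentschler_property"
  then have le: "index \<le> 3" using rentschler_or_index_plus_4_le n by linarith
  have "max_abelian_dim \<ge> 3" using max_abelian_dim_ge_3[OF assms(1)] n by linarith
  have few: "2 * max_abelian_dim + 2 < dim UNIV + index"
    using no rentschler_propertyI by (meson not_le)
  then have "index \<ge> 2" using \<open>max_abelian_dim \<ge> 3\<close> n by linarith
  moreover have "index \<noteq> 2" using even_dim_minus_index unfolding n by auto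
  ultimately have i: "index = 3" using le by linarith
  then have "index + 1 \<le> max_abelian_dim"
    using max_abelian_dim_if_not_quasi_quadratic index n by simp
  then show False using few i n by linarith
qed

end

theorem theorem5p2:
  fixes scale :: "'k::{alg_closed_field, field_char_0} \<Rightarrow> 'v::ab_group_add \<Rightarrow> 'v"
    and bracket :: "'v \<Rightarrow> 'v \<Rightarrow> 'v"
    and n :: nat
  assumes "finite_dimensional_lie_algebra scale bracket"
    and "lie_algebra.solvable scale bracket"
    and "vector_space.dim scale UNIV = n"
  shows "(n \<le> 6 \<longrightarrow> lie_algebra.rentschler_property scale bracket) \<and>
    (n = 7 \<and>
      (lie_algebra.index scale bracket \<noteq> 3 \<or>
       (lie_algebra.index scale bracket = 3 \<and> \<not> lie_algebra.quasi_quadratic scale bracket))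
      \<longrightarrow> lie_algebra.rentschler_property scale bracket)"
proof -
  interpret alg_closed_lie_algebra scale bracket
    using assms(1) by (simp add: alg_closed_lie_algebra_def)
  show ?thesis
    using rentschler_dim_le_6 rentschler_dim_7 assms(2,3) by blast
qed

end
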